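(* Let $n\ge2$, let $G=(V,E)$ be an undirected graph (self-loops allowed) with $V=\{1,\dots,n\}$, and let $1\le r\le n$. Then $\mathcal P(\mathcal S^n_{r+})$ is closed if and only if the restricted projections $\mathcal P_{H_i}(\mathcal S^{n_i}_{r+})$ are closed for all connected components $H_i$ of $G$, where $n_i=|H_i|$.
   Context: For $m\ge1$, $\mathcal S^m$ is the space of real symmetric $m\times m$ matrices and $\mathcal S^m_{r+}\subseteq\mathcal S^m$ is the set of positive semidefinite matrices of rank at most $r$ (all positive semidefinite matrices if $r\ge m$). The graph $G=(V,E)$ has index set $E\subseteq\{ij: 1\le i\le j\le n\}$, where $ii\in E$ means that vertex $i$ has a self-loop. $\mathcal P:\mathcal S^n\to\mathbb R^E$ is the coordinate projection $\mathcal P(X)=(X_{ij})_{ij\in E}$. For $H\subseteq V$ let $E_H$ be the set of elements $ij\in E$ with $i,j\in H$; identifying $\mathcal S^{|H|}$ with the symmetric matrices with rows and columns indexed by $H$, $\mathcal P_H:\mathcal S^{|H|}\to\mathbb R^{E_H}$ is $\mathcal P_H(X)=(X_{ij})_{ij\in E_H}$. Connected components are identified with their vertex sets. Closedness of images is in the Euclidean spaces $\mathbb R^E$, $\mathbb R^{E_{H}}$. *)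

theory Defs
  imports "HOL-Analysis.Function_Topology" "Jordan_Normal_Form.DL_Rank"
begin

definition psd_rank_le :: "nat \<Rightarrow> nat \<Rightarrow> real mat set" where
  "psd_rank_le m r =
     {X \<in> carrier_mat m m. X\<^sup>T = X
        \<and> (\<forall>v \<in> carrier_vec m. 0 \<le> scalar_prod v (X *\<^sub>v v))
        \<and> vec_space.rank m X \<le> r}"

text \<open>An undirected graph on a vertex set of natural numbers is given by its set of index pairs
  \<open>(i, j)\<close> with \<open>i \<le> j\<close>; \<open>(i, i)\<close> is a self-loop. The components are the vertex sets of the
  connected components.\<close>

definition graph_components :: "nat set \<Rightarrow> (nat \<times> nat) set \<Rightarrow> nat set set" where
  "graph_components V E = V // {(u, v) \<in> V \<times> V. (u, v) \<in> (E \<union> E\<inverse>)\<^sup>*}"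

definition edges_in :: "(nat \<times> nat) set \<Rightarrow> nat set \<Rightarrow> (nat \<times> nat) set" where
  "edges_in E H = {(i, j) \<in> E. i \<in> H \<and> j \<in> H}"

text \<open>Points of \<open>\<real>\<^sup>E\<close> are functions restricted to \<open>E\<close> (that is, \<open>undefined\<close> off \<open>E\<close>), the points of
  \<open>powertop_real E\<close>. Vertices are numbered from 1, but matrix entries from 0.\<close>

definition coord_proj :: "(nat \<times> nat) set \<Rightarrow> real mat \<Rightarrow> nat \<times> nat \<Rightarrow> real" where
  "coord_proj E X = (\<lambda>(i, j) \<in> E. X $$ (i - 1, j - 1))"

text \<open>A matrix with rows and columns indexed by \<open>H\<close> is a \<open>card H \<times> card H\<close> matrix through the
  increasing enumeration of \<open>H\<close>: the vertex \<open>i \<in> H\<close> has the 0-based position \<open>vertex_pos H i\<close>.\<close>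

definition vertex_pos :: "nat set \<Rightarrow> nat \<Rightarrow> nat" where
  "vertex_pos H i = card {h \<in> H. h < i}"

definition coord_proj_on :: "(nat \<times> nat) set \<Rightarrow> nat set \<Rightarrow> real mat \<Rightarrow> nat \<times> nat \<Rightarrow> real" where
  "coord_proj_on E H X = (\<lambda>(i, j) \<in> edges_in E H. X $$ (vertex_pos H i, vertex_pos H j))"

end

theory Submission
  imports Defs
begin

text \<open>A matrix is positive semidefinite of rank at most \<open>r\<close> iff it is the Gram matrix of vectors in
  \<open>\<real>\<^sup>r\<close>: taking the Schur complement at a positive diagonal entry splits off one coordinate and
  lowers the rank. Hence a point of \<open>\<real>\<^sup>E\<close> lies in the image of the projection iff
  it consists of inner products of vectors attached to the vertices. As no edge joins two
  components, these vectors can be chosen on each component independently, so the image is the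
  intersection of the preimages of the component images under restriction. Conversely, extension
  by zero off \<open>E\<^sub>H\<close> is continuous and pulls the image for \<open>E\<close> back to the image for
  \<open>E\<^sub>H\<close>, because vertices outside \<open>H\<close> may carry the zero vector.\<close>

subsection \<open>Matrix rank\<close>

text \<open>The rank is the dimension of the column span, and independence of \<open>U\<close>
  persists when that span is viewed as a vector space of its own.\<close>

lemma (in vec_space) card_indpt_le_rank:
  assumes A: "A \<in> carrier_mat n nc"
    and U: "U \<subseteq> span (set (cols A))" and li: "lin_indpt U"
  shows "card U \<le> rank A"
proof -
  have cA: "set (cols A) \<subseteq> carrier_vec n"
    using cols_dim A by blast
  have sm: "submodule class_ring (span (set (cols A))) V"
    by (rule span_is_submodule) (use cA in simp)
  have vs: "vectorspace class_ring (span_vs (set (cols A)))"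
    by (rule subspace_is_vs[OF span_is_subspace]) (use cA in simp)
  have fd: "vectorspace.fin_dim class_ring (span_vs (set (cols A)))"
    using fin_dim_span_cols[OF A] .
  have li': "\<not> LinearCombinations.module.lin_dep class_ring (span_vs (set (cols A))) U"
    using span_li_not_depend(2)[OF U sm] li by simp
  show ?thesis
    unfolding rank_def
    by (rule vectorspace.li_le_dim(2)[OF vs fd _ li']) (use U in simp)
qed

text \<open>A maximal independent set of columns of \<open>B\<close> spans a subspace of the
  hyperplane where coordinate \<open>i\<close> vanishes. Since \<open>x\<close> is off that
  hyperplane, adjoining it gives a larger independent set inside the column span of
  \<open>A\<close>.\<close>

lemma (in vec_space) rank_less:
  assumes A: "A \<in> carrier_mat n nc" and B: "B \<in> carrier_mat n nc'"
    and BA: "set (cols B) \<subseteq> span (set (cols A))"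
    and x: "x \<in> span (set (cols A))" and i: "i < n"
    and Bi: "\<And>y. y \<in> set (cols B) \<Longrightarrow> y $ i = 0" and xi: "x $ i \<noteq> 0"
  shows "rank B < rank A"
proof -
  have cA: "set (cols A) \<subseteq> carrier_vec n" and cB: "set (cols B) \<subseteq> carrier_vec n"
    using cols_dim A B by blast+
  have "lin_indpt {}"
    unfolding lin_dep_def by auto
  then obtain S where S: "maximal S (\<lambda>T. T \<subseteq> set (cols B) \<and> lin_indpt T)" "finite S"
    using maximal_exists_superset[of "set (cols B)" "\<lambda>T. T \<subseteq> set (cols B) \<and> lin_indpt T" "{}"]
    by blast
  have SB: "S \<subseteq> set (cols B)" and liS: "lin_indpt S"
    using S(1) unfolding maximal_def by auto
  have cS: "S \<subseteq> carrier_vec n"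
    using SB cB by blast
  have cx: "x \<in> carrier_vec n"
    using span_closed[OF _ x] cA by simp
  have "y $ i = 0" if yS: "y \<in> span S" for y
  proof -
    obtain a T where y: "y = lincomb a T" "finite T" "T \<subseteq> S"
      using in_spanE[OF yS] by blast
    then have "y $ i = (\<Sum>w\<in>T. a w * w $ i)"
      using lincomb_index[OF i] cS by auto
    also have "\<dots> = 0"
      using y(3) SB Bi by (intro sum.neutral) auto
    finally show ?thesis .
  qed
  then have xS: "x \<notin> span S"
    using xi by blast
  then have "x \<notin> S"
    using in_own_span[of S] cS by auto
  then have li: "lin_indpt (S \<union> {x})"
    using lin_dep_iff_in_span[of S x] cS liS cx xS by auto
  have "rank B + 1 = card (S \<union> {x})"
    using rank_card_indpt[OF B S(1)] \<open>x \<notin> S\<close> S(2) by simp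
  also have "\<dots> \<le> rank A"
    using card_indpt_le_rank[OF A _ li] SB BA x by auto
  finally show ?thesis by simp
qed

text \<open>The matrix is a sum of \<open>r\<close> outer products, each of rank at most 1, and rank
  is subadditive.\<close>

lemma rank_gram_le:
  fixes p :: "nat \<Rightarrow> nat \<Rightarrow> real"
  shows "vec_space.rank m (mat m m (\<lambda>(a, b). \<Sum>k<r. p a k * p b k)) \<le> r"
proof (induction r)
  case 0
  have "mat m m (\<lambda>(a, b). \<Sum>k<0. p a k * p b k) = 0\<^sub>m m m"
    by (intro eq_matI) auto
  then show ?case
    using vec_space.rank_0I[of m m, where ?'a = real] by (simp only:)
next
  case (Suc r)
  let ?A = "mat m m (\<lambda>(a, b). \<Sum>k<r. p a k * p b k)"
  let ?B = "mat m m (\<lambda>(a, b). p a r * p b r)"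
  have "mat m m (\<lambda>(a, b). \<Sum>k<Suc r. p a k * p b k) = ?A + ?B"
    by (intro eq_matI) auto
  moreover have "vec_space.rank m (?A + ?B) \<le> vec_space.rank m ?A + vec_space.rank m ?B"
    by (rule vec_space.rank_subadditive) auto
  moreover have "vec_space.rank m ?B \<le> 1"
    by (rule vec_space.rank_le_1_product_entries[where f = "\<lambda>a. p a r" and g = "\<lambda>b. p b r"]) auto
  ultimately show ?case
    using Suc by simp
qed

subsection \<open>Positive semidefinite matrices of bounded rank are Gram matrices\<close>

lemma mult_mat_unit_vec:
  fixes A :: "'a :: semiring_1 mat"
  assumes "A \<in> carrier_mat m n" and "i < n"
  shows "A *\<^sub>v unit_vec n i = col A i"
  using assms by (intro eq_vecI) auto

text \<open>Used twice: with \<open>v\<close> a unit vector, to force off-diagonal entries to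
  vanish, and with the minimizing \<open>t\<close>, to obtain the form of the Schur
  complement.\<close>

lemma quadratic_form_minus_unit:
  fixes X :: "real mat" and t :: real
  assumes X: "X \<in> carrier_mat m m" and sym: "X\<^sup>T = X"
    and v: "v \<in> carrier_vec m" and i: "i < m"
  defines "w \<equiv> v - t \<cdot>\<^sub>v unit_vec m i"
  shows "scalar_prod w (X *\<^sub>v w) =
    scalar_prod v (X *\<^sub>v v) - 2 * t * (X *\<^sub>v v) $ i + t\<^sup>2 * X $$ (i, i)"
proof -
  have e: "unit_vec m i \<in> carrier_vec m" and cc: "col X i \<in> carrier_vec m"
    and Xv: "X *\<^sub>v v \<in> carrier_vec m"
    using X v by auto
  have "X *\<^sub>v w = X *\<^sub>v v - X *\<^sub>v (t \<cdot>\<^sub>v unit_vec m i)"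
    unfolding w_def using X v by (intro mult_minus_distrib_mat_vec) auto
  also have "X *\<^sub>v (t \<cdot>\<^sub>v unit_vec m i) = t \<cdot>\<^sub>v col X i"
    using mult_mat_vec[OF X e] mult_mat_unit_vec[OF X i] by simp
  finally have Xw: "X *\<^sub>v w = X *\<^sub>v v - t \<cdot>\<^sub>v col X i" .
  \<comment> \<open>By symmetry, column \<open>i\<close> is also row \<open>i\<close>.\<close>
  have vc: "scalar_prod v (col X i) = (X *\<^sub>v v) $ i"
  proof -
    have "col X i = row X i"
      using sym X i by (metis carrier_matD(1) row_transpose carrier_matD(2))
    then show ?thesis
      using X i v comm_scalar_prod[OF v cc] by simp
  qed
  have ii: "col X i $ i = X $$ (i, i)"
    using X i by simp
  have "X *\<^sub>v w \<in> carrier_vec m"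
    unfolding Xw using Xv cc by simp
  then have "scalar_prod w (X *\<^sub>v w)
      = scalar_prod v (X *\<^sub>v w) - scalar_prod (t \<cdot>\<^sub>v unit_vec m i) (X *\<^sub>v w)"
    unfolding w_def using v by (intro minus_scalar_prod_distrib) auto
  also have "scalar_prod (t \<cdot>\<^sub>v unit_vec m i) (X *\<^sub>v w) = t * (X *\<^sub>v w) $ i"
    unfolding Xw using i Xv cc X
    by (subst scalar_prod_smult_left) auto
  also have "(X *\<^sub>v w) $ i = (X *\<^sub>v v) $ i - t * X $$ (i, i)"
    unfolding Xw using i Xv cc X by (simp add: ii)
  also have "scalar_prod v (X *\<^sub>v w) = scalar_prod v (X *\<^sub>v v) - t * (X *\<^sub>v v) $ i"
    unfolding Xw using scalar_prod_minus_distrib[OF v Xv, of "t \<cdot>\<^sub>v col X i"] cc v vc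
    by simp
  finally show ?thesis
    by (simp add: algebra_simps power2_eq_square)
qed

text \<open>With both diagonal entries zero, the form at \<open>e_j - X_ij e_i\<close> equals
  \<open>-2 X_ij^2\<close>, which must be nonnegative.\<close>

lemma psd_zero_diag:
  fixes X :: "real mat"
  assumes X: "X \<in> carrier_mat m m" and sym: "X\<^sup>T = X"
    and psd: "\<forall>v \<in> carrier_vec m. 0 \<le> scalar_prod v (X *\<^sub>v v)"
    and ij: "i < m" "j < m" and diag: "X $$ (i, i) = 0" "X $$ (j, j) = 0"
  shows "X $$ (i, j) = 0"
proof -
  have Xe: "X *\<^sub>v unit_vec m j = col X j"
    using mult_mat_unit_vec[OF X ij(2)] .
  have "scalar_prod (unit_vec m j) (X *\<^sub>v unit_vec m j) = 0"
    unfolding Xe using ij X diag by simp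
  moreover have "(X *\<^sub>v unit_vec m j) $ i = X $$ (i, j)"
    unfolding Xe using ij X by simp
  moreover have "0 \<le> scalar_prod (unit_vec m j - X $$ (i, j) \<cdot>\<^sub>v unit_vec m i)
      (X *\<^sub>v (unit_vec m j - X $$ (i, j) \<cdot>\<^sub>v unit_vec m i))"
    using psd by auto
  ultimately have "0 \<le> - 2 * (X $$ (i, j))\<^sup>2"
    using quadratic_form_minus_unit[OF X sym unit_vec_carrier ij(1), of j "X $$ (i, j)"] diag
    by (simp add: power2_eq_square)
  then show ?thesis
    by simp
qed

lemma psd_diag_nonneg:
  fixes X :: "real mat"
  assumes X: "X \<in> carrier_mat m m"
    and psd: "\<forall>v \<in> carrier_vec m. 0 \<le> scalar_prod v (X *\<^sub>v v)" and i: "i < m"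
  shows "0 \<le> X $$ (i, i)"
proof -
  have "scalar_prod (unit_vec m i) (X *\<^sub>v unit_vec m i) = X $$ (i, i)"
    unfolding mult_mat_unit_vec[OF X i] using i X by simp
  then show ?thesis
    using psd unit_vec_carrier by metis
qed

text \<open>\<open>Y\<close> is the Schur complement at entry \<open>(i, i)\<close>, padded with a
  zero row and column so that the size stays \<open>m\<close>. Its form at \<open>v\<close> is the
  minimum over \<open>t\<close> of the form of \<open>X\<close> at \<open>v - t e_i\<close>. Its
  columns are combinations of columns of \<open>X\<close> and vanish at \<open>i\<close>, whereas
  column \<open>i\<close> of \<open>X\<close> does not, so the rank drops.\<close>

lemma psd_schur_complement:
  fixes X :: "real mat"
  assumes X: "X \<in> carrier_mat m m" and sym: "X\<^sup>T = X"
    and psd: "\<forall>v \<in> carrier_vec m. 0 \<le> scalar_prod v (X *\<^sub>v v)"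
    and i: "i < m" and pos: "X $$ (i, i) > 0"
  defines "Y \<equiv> mat m m (\<lambda>(a, b). X $$ (a, b) - X $$ (a, i) * X $$ (b, i) / X $$ (i, i))"
  shows "Y\<^sup>T = Y" and "\<forall>v \<in> carrier_vec m. 0 \<le> scalar_prod v (Y *\<^sub>v v)"
    and "vec_space.rank m Y < vec_space.rank m X"
proof -
  have Y: "Y \<in> carrier_mat m m"
    unfolding Y_def by simp
  have s: "X $$ (a, b) = X $$ (b, a)" if "a < m" "b < m" for a b
    using sym X that by (metis carrier_matD index_transpose_mat(1))
  show "Y\<^sup>T = Y"
    unfolding Y_def by (intro eq_matI) (auto simp: s)
  show "\<forall>v \<in> carrier_vec m. 0 \<le> scalar_prod v (Y *\<^sub>v v)"
  proof
    fix v :: "real vec" assume v: "v \<in> carrier_vec m"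
    \<comment> \<open>The minimizer of the quadratic polynomial in \<open>t\<close> from
      \<open>quadratic_form_minus_unit\<close>.\<close>
    define t where "t = (X *\<^sub>v v) $ i / X $$ (i, i)"
    have cc: "col X i \<in> carrier_vec m" and Xv: "X *\<^sub>v v \<in> carrier_vec m"
      using X v by auto
    have Xvi: "(X *\<^sub>v v) $ i = (\<Sum>b = 0..<m. X $$ (b, i) * v $ b)"
      using X v i by (simp add: scalar_prod_def) (intro sum.cong; simp add: s)
    have "Y *\<^sub>v v = X *\<^sub>v v - t \<cdot>\<^sub>v col X i"
    proof (rule eq_vecI)
      fix a assume "a < dim_vec (X *\<^sub>v v - t \<cdot>\<^sub>v col X i)"
      then have a: "a < m" using X by simp
      have "(Y *\<^sub>v v) $ a
          = (\<Sum>b = 0..<m. (X $$ (a, b) - X $$ (a, i) * X $$ (b, i) / X $$ (i, i)) * v $ b)"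
        using Y v a by (simp add: scalar_prod_def) (intro sum.cong; simp add: Y_def)
      also have "\<dots> = (\<Sum>b = 0..<m. X $$ (a, b) * v $ b)
          - X $$ (a, i) / X $$ (i, i) * (\<Sum>b = 0..<m. X $$ (b, i) * v $ b)"
        by (simp add: sum_distrib_left sum_subtractf[symmetric] algebra_simps)
      also have "\<dots> = (X *\<^sub>v v - t \<cdot>\<^sub>v col X i) $ a"
        using X v a i by (simp add: t_def Xvi[symmetric]) (simp add: scalar_prod_def)
      finally show "(Y *\<^sub>v v) $ a = (X *\<^sub>v v - t \<cdot>\<^sub>v col X i) $ a" .
    qed (use X Y in simp)
    moreover have "scalar_prod v (col X i) = (X *\<^sub>v v) $ i"
      using X v i unfolding Xvi by (simp add: scalar_prod_def mult.commute)
    ultimately have "scalar_prod v (Y *\<^sub>v v) = scalar_prod v (X *\<^sub>v v) - t * (X *\<^sub>v v) $ i"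
      using scalar_prod_minus_distrib[OF v Xv, of "t \<cdot>\<^sub>v col X i"] cc v by simp
    \<comment> \<open>For this \<open>t\<close>, the square term \<open>t^2 X_ii\<close> equals
      \<open>t (X v)_i\<close>, so it cancels half of the cross term.\<close>
    also have "\<dots> = scalar_prod v (X *\<^sub>v v) - 2 * t * (X *\<^sub>v v) $ i + t\<^sup>2 * X $$ (i, i)"
      using pos by (simp add: t_def power2_eq_square)
    also have "\<dots> \<ge> 0"
      using psd v unfolding quadratic_form_minus_unit[OF X sym v i, symmetric] by simp
    finally show "0 \<le> scalar_prod v (Y *\<^sub>v v)" .
  qed
  interpret vec_space "TYPE(real)" m .
  have cX: "set (cols X) \<subseteq> carrier_vec m"
    using cols_dim X by blast
  have colX: "col X b \<in> span (set (cols X))" if "b < m" for b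
    using in_own_span[of "set (cols X)"] cX that X by (auto simp: cols_def)
  show "rank Y < rank X"
  proof (rule rank_less[OF X Y _ colX[OF i] i])
    show "set (cols Y) \<subseteq> span (set (cols X))"
    proof
      fix y assume "y \<in> set (cols Y)"
      then obtain b where b: "b < m" "y = col Y b"
        using Y by (auto simp: cols_def)
      have "y = col X b + (- X $$ (b, i) / X $$ (i, i)) \<cdot>\<^sub>v col X i"
        unfolding b(2) using b(1) i X Y by (intro eq_vecI) (auto simp: Y_def)
      then show "y \<in> span (set (cols X))"
        using span_add1[of "set (cols X)" "col X b"] smult_in_span[OF cX] colX b(1) i cX by simp
    qed
    show "y $ i = 0" if "y \<in> set (cols Y)" for y
      using that Y i pos s by (auto simp: cols_def Y_def)
    show "col X i $ i \<noteq> 0"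
      using X i pos by simp
  qed
qed

text \<open>Induction on the rank bound: each Schur complement step subtracts an outer product,
  whose factor becomes the last coordinate of the Gram vectors. Without a positive diagonal entry
  the matrix is zero.\<close>

lemma psd_rank_le_imp_gram:
  assumes "X \<in> psd_rank_le m r"
  shows "\<exists>p :: nat \<Rightarrow> nat \<Rightarrow> real. \<forall>a<m. \<forall>b<m. X $$ (a, b) = (\<Sum>k<r. p a k * p b k)"
  using assms
proof (induction r arbitrary: X)
  case 0
  have X: "X \<in> carrier_mat m m" and sym: "X\<^sup>T = X"
    and psd: "\<forall>v \<in> carrier_vec m. 0 \<le> scalar_prod v (X *\<^sub>v v)" and rk: "vec_space.rank m X = 0"
    using 0 by (auto simp: psd_rank_le_def)
  \<comment> \<open>A positive diagonal entry would allow a strict drop below rank 0.\<close>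
  have "X $$ (i, i) = 0" if "i < m" for i
    using psd_diag_nonneg[OF X psd that] psd_schur_complement(3)[OF X sym psd that] rk by force
  then show ?case
    using psd_zero_diag[OF X sym psd] by simp
next
  case (Suc r)
  have X: "X \<in> carrier_mat m m" and sym: "X\<^sup>T = X"
    and psd: "\<forall>v \<in> carrier_vec m. 0 \<le> scalar_prod v (X *\<^sub>v v)" and rk: "vec_space.rank m X \<le> Suc r"
    using Suc.prems by (auto simp: psd_rank_le_def)
  show ?case
  proof (cases "\<exists>i<m. X $$ (i, i) > 0")
    case True
    then obtain i where i: "i < m" "X $$ (i, i) > 0" by blast
    define Y where "Y = mat m m (\<lambda>(a, b). X $$ (a, b) - X $$ (a, i) * X $$ (b, i) / X $$ (i, i))"
    have "Y \<in> psd_rank_le m r"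
      using psd_schur_complement[OF X sym psd i, folded Y_def] rk
      by (auto simp: psd_rank_le_def) (auto simp: Y_def)
    then obtain p :: "nat \<Rightarrow> nat \<Rightarrow> real"
      where p: "\<And>a b. a < m \<Longrightarrow> b < m \<Longrightarrow> Y $$ (a, b) = (\<Sum>k<r. p a k * p b k)"
      using Suc.IH by blast
    \<comment> \<open>The square root splits the subtracted term \<open>X_ai X_bi / X_ii\<close>
      evenly between the two factors.\<close>
    let ?p = "\<lambda>a k. if k < r then p a k else X $$ (a, i) / sqrt (X $$ (i, i))"
    have "X $$ (a, b) = (\<Sum>k<Suc r. ?p a k * ?p b k)" if "a < m" "b < m" for a b
      using p[OF that] that i(2) by (simp add: Y_def)
    then show ?thesis by (intro exI[of _ ?p]) blast
  next
    case False
    then have "X $$ (i, i) = 0" if "i < m" for i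
      using psd_diag_nonneg[OF X psd that] that by force
    then have "\<forall>a<m. \<forall>b<m. X $$ (a, b) = (\<Sum>k<Suc r. (0 :: real) * 0)"
      using psd_zero_diag[OF X sym psd] by simp
    then show ?thesis by (intro exI[of _ "\<lambda>_ _. 0"])
  qed
qed

text \<open>Moving the sum over \<open>k\<close> outermost turns the quadratic form into a sum of
  \<open>r\<close> squares.\<close>

lemma gram_in_psd_rank_le:
  fixes p :: "nat \<Rightarrow> nat \<Rightarrow> real"
  shows "mat m m (\<lambda>(a, b). \<Sum>k<r. p a k * p b k) \<in> psd_rank_le m r" (is "?X \<in> _")
proof -
  have "0 \<le> scalar_prod v (?X *\<^sub>v v)" if v: "v \<in> carrier_vec m" for v
  proof -
    have "scalar_prod v (?X *\<^sub>v v)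
        = (\<Sum>a = 0..<m. v $ a * (\<Sum>b = 0..<m. (\<Sum>k<r. p a k * p b k) * v $ b))"
      using v by (simp add: scalar_prod_def)
    also have "\<dots> = (\<Sum>a = 0..<m. \<Sum>b = 0..<m. \<Sum>k<r. (v $ a * p a k) * (v $ b * p b k))"
      by (simp add: sum_distrib_left sum_distrib_right mult_ac)
    also have "\<dots> = (\<Sum>a = 0..<m. \<Sum>k<r. \<Sum>b = 0..<m. (v $ a * p a k) * (v $ b * p b k))"
      by (intro sum.cong refl sum.swap)
    also have "\<dots> = (\<Sum>k<r. \<Sum>a = 0..<m. \<Sum>b = 0..<m. (v $ a * p a k) * (v $ b * p b k))"
      by (rule sum.swap)
    also have "\<dots> = (\<Sum>k<r. (\<Sum>a = 0..<m. v $ a * p a k)\<^sup>2)"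
      by (simp add: power2_eq_square sum_product)
    also have "\<dots> \<ge> 0"
      by (intro sum_nonneg) simp
    finally show ?thesis .
  qed
  moreover have "?X\<^sup>T = ?X"
    by (intro eq_matI) (auto simp: mult.commute)
  ultimately show ?thesis
    using rank_gram_le[of m p r] by (simp add: psd_rank_le_def)
qed

subsection \<open>Partial Gram matrices\<close>

text \<open>Vectors are attached to vertex labels rather than to matrix positions, so passing to a
  subset of the vertices requires no renumbering. Only coordinates below \<open>r\<close> of
  \<open>p i\<close> matter.\<close>

definition partial_gram :: "(nat \<times> nat) set \<Rightarrow> nat \<Rightarrow> (nat \<times> nat \<Rightarrow> real) set" where
  "partial_gram F r = range (\<lambda>p. \<lambda>(i, j) \<in> F. \<Sum>k<r. p i k * p j k)"

text \<open>The map \<open>f\<close> sends labels to matrix positions. It covers both the shift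
  \<open>i - 1\<close> for the whole graph and \<open>vertex_pos H\<close> for a component.\<close>

lemma image_psd_rank_le_eq_partial_gram:
  assumes inj: "inj_on f A" and less: "\<And>i. i \<in> A \<Longrightarrow> f i < m" and F: "F \<subseteq> A \<times> A"
  shows "(\<lambda>X. \<lambda>(i, j) \<in> F. X $$ (f i, f j)) ` psd_rank_le m r = partial_gram F r"
proof (intro equalityI subsetI)
  fix y assume "y \<in> (\<lambda>X. \<lambda>(i, j) \<in> F. X $$ (f i, f j)) ` psd_rank_le m r"
  then obtain X where X: "X \<in> psd_rank_le m r" and y: "y = (\<lambda>(i, j) \<in> F. X $$ (f i, f j))"
    by blast
  obtain p :: "nat \<Rightarrow> nat \<Rightarrow> real"
    where "\<forall>a<m. \<forall>b<m. X $$ (a, b) = (\<Sum>k<r. p a k * p b k)"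
    using psd_rank_le_imp_gram[OF X] by blast
  then have "y = (\<lambda>(i, j) \<in> F. \<Sum>k<r. p (f i) k * p (f j) k)"
    unfolding y using F less by (intro restrict_ext) auto
  then show "y \<in> partial_gram F r"
    unfolding partial_gram_def by (intro range_eqI[where x = "\<lambda>i. p (f i)"]) simp
next
  fix y assume "y \<in> partial_gram F r"
  then obtain p :: "nat \<Rightarrow> nat \<Rightarrow> real" where y: "y = (\<lambda>(i, j) \<in> F. \<Sum>k<r. p i k * p j k)"
    unfolding partial_gram_def by blast
  \<comment> \<open>Carries the vectors from labels to positions. Positions outside the range of
    \<open>f\<close> on \<open>A\<close> get unspecified vectors, but their entries are never
    read.\<close>
  define q where "q a = p (the_inv_into A f a)" for a
  have "q (f i) = p i" if "i \<in> A" for i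
    using the_inv_into_f_f[OF inj that] by (simp add: q_def)
  then have "y = (\<lambda>(i, j) \<in> F. mat m m (\<lambda>(a, b). \<Sum>k<r. q a k * q b k) $$ (f i, f j))"
    unfolding y using F less by (intro restrict_ext) auto
  then show "y \<in> (\<lambda>X. \<lambda>(i, j) \<in> F. X $$ (f i, f j)) ` psd_rank_le m r"
    using gram_in_psd_rank_le by blast
qed

lemma vertex_pos_strict_mono:
  assumes "finite H" and "i \<in> H" and "i < j"
  shows "vertex_pos H i < vertex_pos H j"
  unfolding vertex_pos_def using assms by (intro psubset_card_mono) auto

lemma inj_on_vertex_pos:
  assumes "finite H"
  shows "inj_on (vertex_pos H) H"
  by (metis assms inj_onI less_irrefl linorder_neqE_nat vertex_pos_strict_mono)

lemma vertex_pos_less_card: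
  assumes "finite H" and "i \<in> H"
  shows "vertex_pos H i < card H"
  unfolding vertex_pos_def using assms by (intro psubset_card_mono) auto

subsection \<open>Gluing over the connected components\<close>

lemma closedin_partial_gram_edges_in:
  assumes cl: "closedin (powertop_real E) (partial_gram E r)"
  shows "closedin (powertop_real (edges_in E H)) (partial_gram (edges_in E H) r)"
proof -
  let ?F = "edges_in E H"
  have FE: "?F \<subseteq> E"
    by (auto simp: edges_in_def)
  \<comment> \<open>Zero on the edges of \<open>E\<close> not inside \<open>H\<close>, and
    \<open>undefined\<close> off \<open>E\<close> as points of \<open>powertop_real E\<close> must
    be.\<close>
  define ext :: "(nat \<times> nat \<Rightarrow> real) \<Rightarrow> nat \<times> nat \<Rightarrow> real"
    where "ext y = (\<lambda>e \<in> E. if e \<in> ?F then y e else 0)" for y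
  have cont: "continuous_map (powertop_real ?F) (powertop_real E) ext"
  proof (rule continuous_map_coordinatewise_then_product)
    fix e assume "e \<in> E"
    then show "continuous_map (powertop_real ?F) euclideanreal (\<lambda>y. ext y e)"
      by (cases "e \<in> ?F") (auto simp: ext_def intro: continuous_map_product_projection)
  qed (auto simp: ext_def)
  have "y \<in> partial_gram ?F r \<longleftrightarrow> y \<in> topspace (powertop_real ?F) \<and> ext y \<in> partial_gram E r" for y
  proof
    assume "y \<in> partial_gram ?F r"
    then obtain p where y: "y = (\<lambda>(i, j) \<in> ?F. \<Sum>k<r. p i k * p j k)"
      unfolding partial_gram_def by blast
    \<comment> \<open>Zero vectors outside \<open>H\<close> produce exactly the zeros of the
      extension.\<close>
    have "ext y = (\<lambda>(i, j) \<in> E. \<Sum>k<r. (if i \<in> H then p i k else 0) * (if j \<in> H then p j k else 0))"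
      unfolding ext_def y
    proof (intro restrict_ext)
      fix e assume "e \<in> E"
      obtain i j where "e = (i, j)"
        by (cases e)
      with \<open>e \<in> E\<close> show "(if e \<in> ?F then (\<lambda>(i, j) \<in> ?F. \<Sum>k<r. p i k * p j k) e else 0)
          = (case e of (i, j) \<Rightarrow> \<Sum>k<r. (if i \<in> H then p i k else 0) * (if j \<in> H then p j k else 0))"
        by (cases "i \<in> H"; cases "j \<in> H") (auto simp: edges_in_def)
    qed
    then have "ext y \<in> partial_gram E r"
      unfolding partial_gram_def
      by (intro range_eqI[where x = "\<lambda>i k. if i \<in> H then p i k else 0"]) simp
    then show "y \<in> topspace (powertop_real ?F) \<and> ext y \<in> partial_gram E r"
      by (simp add: y)
  next
    assume y: "y \<in> topspace (powertop_real ?F) \<and> ext y \<in> partial_gram E r"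
    then obtain p where p: "ext y = (\<lambda>(i, j) \<in> E. \<Sum>k<r. p i k * p j k)"
      unfolding partial_gram_def by blast
    \<comment> \<open>Off \<open>?F\<close> both sides are \<open>undefined\<close>, the left one
      because \<open>y\<close> is in the product space.\<close>
    have "y = restrict (ext y) ?F"
      using y FE by (auto simp: ext_def fun_eq_iff restrict_def PiE_def extensional_def)
    also have "\<dots> = (\<lambda>(i, j) \<in> ?F. \<Sum>k<r. p i k * p j k)"
      unfolding p using FE by (intro restrict_ext) auto
    finally show "y \<in> partial_gram ?F r"
      unfolding partial_gram_def by blast
  qed
  then have "partial_gram ?F r = {y \<in> topspace (powertop_real ?F). ext y \<in> partial_gram E r}"
    by blast
  then show ?thesis
    using closedin_continuous_map_preimage[OF cont cl] by simp
qed

lemma closedin_partial_gram_components: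
  assumes E: "E \<subseteq> V \<times> V"
    and cl: "\<And>H. H \<in> graph_components V E \<Longrightarrow>
      closedin (powertop_real (edges_in E H)) (partial_gram (edges_in E H) r)"
  shows "closedin (powertop_real E) (partial_gram E r)"
proof -
  define R where "R = {(u, v) \<in> V \<times> V. (u, v) \<in> (E \<union> E\<inverse>)\<^sup>*}"
  have "sym (E \<union> E\<inverse>)"
    by (auto simp: sym_def)
  then have R: "equiv V R"
    by (intro equivI refl_onI symI transI) (auto simp: R_def dest: symD[OF sym_rtrancl] intro: rtrancl_trans)
  have comps: "graph_components V E = V // R"
    by (simp add: graph_components_def R_def)
  \<comment> \<open>Both ends of an edge lie in one class, so every edge is inside some
    component.\<close>
  have edge: "R `` {i} \<in> V // R" "i \<in> R `` {i}" "j \<in> R `` {i}" "R `` {j} = R `` {i}"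
    if "(i, j) \<in> E" for i j
  proof -
    have i: "i \<in> V" and ij: "(i, j) \<in> R"
      using that E by (auto simp: R_def)
    show "R `` {i} \<in> V // R"
      using i by (rule quotientI)
    show "i \<in> R `` {i}"
      using R i by (rule equiv_class_self)
    show "j \<in> R `` {i}"
      using ij by simp
    show "R `` {j} = R `` {i}"
      using equiv_class_eq[OF R ij] by simp
  qed
  let ?S = "\<lambda>H. {y \<in> topspace (powertop_real E).
    restrict y (edges_in E H) \<in> partial_gram (edges_in E H) r}"
  have S: "closedin (powertop_real E) (?S H)" if "H \<in> V // R" for H
    by (rule closedin_continuous_map_preimage[OF continuous_on_restrict])
      (use that cl comps in \<open>auto simp: edges_in_def\<close>)
  \<comment> \<open>Inserting the whole space keeps the family nonempty even if there are no
    components, and makes every \<open>y\<close> in the intersection \<open>undefined\<close> off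
    \<open>E\<close>.\<close>
  have "partial_gram E r = \<Inter> (insert (topspace (powertop_real E)) (?S ` (V // R)))" (is "_ = ?I")
  proof (intro equalityI subsetI)
    fix y assume "y \<in> partial_gram E r"
    then obtain p where y: "y = (\<lambda>(i, j) \<in> E. \<Sum>k<r. p i k * p j k)"
      unfolding partial_gram_def by blast
    have "restrict y (edges_in E H) = (\<lambda>(i, j) \<in> edges_in E H. \<Sum>k<r. p i k * p j k)" for H
      unfolding y by (intro restrict_ext) (auto simp: edges_in_def)
    then show "y \<in> ?I"
      by (auto simp: y partial_gram_def)
  next
    fix y assume y: "y \<in> ?I"
    then have "\<forall>H \<in> V // R. \<exists>p. restrict y (edges_in E H)
        = (\<lambda>(i, j) \<in> edges_in E H. \<Sum>k<r. p i k * p j k)"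
      by (auto simp: partial_gram_def)
    from bchoice[OF this] obtain P where P: "\<And>H. H \<in> V // R \<Longrightarrow> restrict y (edges_in E H)
        = (\<lambda>(i, j) \<in> edges_in E H. \<Sum>k<r. P H i k * P H j k)"
      by blast
    \<comment> \<open>Each vertex takes its vector from the family chosen for its own component. The
      two ends of an edge use the same family, so the prescribed value is recovered.\<close>
    have val: "y (i, j) = (\<Sum>k<r. P (R `` {i}) i k * P (R `` {j}) j k)" if ij: "(i, j) \<in> E" for i j
    proof -
      have "(i, j) \<in> edges_in E (R `` {i})"
        using ij edge[OF ij] by (simp add: edges_in_def)
      then show ?thesis
        using fun_cong[OF P[OF edge(1)[OF ij]], of "(i, j)"] edge(4)[OF ij] by simp
    qed
    have "y = (\<lambda>(i, j) \<in> E. \<Sum>k<r. P (R `` {i}) i k * P (R `` {j}) j k)"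
      using y by (auto simp: fun_eq_iff val PiE_def extensional_def)
    then show "y \<in> partial_gram E r"
      unfolding partial_gram_def
      by (intro range_eqI[where x = "\<lambda>i. P (R `` {i}) i"]) simp
  qed
  moreover have "closedin (powertop_real E) ?I"
    using S closedin_topspace by (intro closedin_Inter) blast+
  ultimately show ?thesis
    by simp
qed

theorem corollary2p1:
  fixes n r :: nat and E :: "(nat \<times> nat) set"
  assumes "n \<ge> 2"
    and "E \<subseteq> {(i, j). 1 \<le> i \<and> i \<le> j \<and> j \<le> n}"
    and "1 \<le> r" and "r \<le> n"
  shows "closedin (powertop_real E) (coord_proj E ` psd_rank_le n r)
    \<longleftrightarrow> (\<forall>H \<in> graph_components {1..n} E.
          closedin (powertop_real (edges_in E H)) (coord_proj_on E H ` psd_rank_le (card H) r))"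
proof -
  have E: "E \<subseteq> {1..n} \<times> {1..n}"
    using assms(2) by force
  \<comment> \<open>Truncated subtraction makes \<open>i - 1\<close> injective here because the
    vertices start at 1.\<close>
  have 1: "coord_proj E ` psd_rank_le n r = partial_gram E r"
    unfolding coord_proj_def
    by (rule image_psd_rank_le_eq_partial_gram[OF _ _ E]) (auto simp: inj_on_def)
  have "coord_proj_on E H ` psd_rank_le (card H) r = partial_gram (edges_in E H) r"
    if "H \<in> graph_components {1..n} E" for H
  proof -
    have "H \<subseteq> {1..n}"
      using that by (auto simp: graph_components_def quotient_def)
    then have "finite H"
      using finite_subset by blast
    then show ?thesis
      unfolding coord_proj_on_def
      by (intro image_psd_rank_le_eq_partial_gram[OF inj_on_vertex_pos vertex_pos_less_card])
        (auto simp: edges_in_def)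
  qed
  then show ?thesis
    unfolding 1
    using closedin_partial_gram_edges_in closedin_partial_gram_components[OF E] by auto
qed

end
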